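(* Consider optional XAI regulation in the duopoly model described in the context. Asking for full explanations is not always the best decision when the policy-maker's objective is the total number of firms that offer XAI or the average XAI level: for each of these two objectives there exist a horizontal differentiation of the firms ('max' or 'min') and parameters $\beta>0$, $t>0$ such that $\xi=1$ does not maximize the objective over $\xi\in[0,1]$.
   Context: Model. Two firms $i=1,2$; parameters $\beta>0$ (quality cost) and $t>0$ (misfit cost). Customers $(x,\theta)$ are uniformly distributed on $[0,1]^2$. A customer buying from firm $i$ with quality $q_i\ge 0$, price $p_i\ge0$, XAI level $\xi_i\in[0,1]$ and location (XAI method) $e_i$ has utility $u_i=V+\theta q_i-p_i-t(1-\xi_i)|x-e_i|$, where the reservation value $V$ is large enough that every customer's utility is positive in equilibrium and every customer makes exactly one purchase, from the firm giving the higher utility. Firm 1 is the high-quality firm ($q_1\ge q_2$). Locations are exogenous: 'max' means $e_1=0,e_2=1$; 'min' means $e_1=e_2=1/2$. The demand $d_i$ is the area of the set of customers buying from $i$; profit is $\pi_i=p_id_i-\beta q_i^2$. Optional regulation. The policy-maker chooses $\xi\in[0,1]$; each firm chooses $\xi_i\in\{0,\xi\}$ (stage 0), then qualities (stage 1), then prices (stage 2). A market is quality-dominated (Q) if for every $x\in[0,1]$ there is an indifferent customer, and explanation-dominated (E) if for every $\theta\in[0,1]$ there is an indifferent customer. The possible equilibria, with their conditions and outcomes, are: (Q2; 'max' or 'min') $\xi_1=\xi_2=\xi$, both firms offer XAI, possible iff $\beta t\,\xi<4/9$: $p_1=\frac{4}{27\beta}$, $p_2=\frac{2}{27\beta}$,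 $q_1=\frac{2}{9\beta}$, $q_2=0$, $\pi_1=\frac{4}{81\beta}$, $\pi_2=\frac{2}{81\beta}$. (E0; 'max') $\xi_1=\xi_2=0$, no firm offers XAI, possible iff $\beta t>\frac{1}{6(2\xi^2-7\xi+6)}$ and $\xi\le 1-\frac1{36\beta t}$: $p_1=p_2=t$, $q_1=q_2=\frac1{12\beta}$, $\pi_1=\pi_2=\frac t2-\frac1{144\beta}$. (E1; 'max') $\xi_1=\xi,\ \xi_2=0$, only firm 1 offers XAI, possible iff $\beta t>\frac{1}{6(2\xi^2-7\xi+6)}$ and $\xi>1-\frac1{36\beta t}$. With $a=\beta t$, $N_1=36a-12a\xi-1$, $N_2=36a-24a\xi-1$, $D=36a-18a\xi-1$, $M=72a-36a\xi-1$: $p_i=\frac{t(2-\xi)N_i}{2D}$, $q_i=\frac{N_i}{12\beta D}$, $\pi_i=\frac{N_i^2M}{144\beta D^2}$. (E1; 'min') $\xi_1=\xi,\ \xi_2=0$, only firm 1 offers XAI, possible iff $\beta t\,\xi>2/9$. With $\psi=\beta t\xi$: $p_1=\frac{t\xi(12\psi-1)}{4(9\psi-1)}$, $p_2=\frac{t\xi(6\psi-1)}{4(9\psi-1)}$, $q_1=\frac{12\psi-1}{12\beta(9\psi-1)}$, $q_2=\frac{6\psi-1}{12\beta(9\psi-1)}$, $\pi_1=\frac{(18\psi-1)(12\psi-1)^2}{144\beta(9\psi-1)^2}$, $\pi_2=\frac{(18\psi-1)(6\psi-1)^2}{144\beta(9\psi-1)^2}$. Market selection. If only one market (E or Q) is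 possible, it forms. If both are possible, each firm prefers the one giving it the higher profit; if the firms agree, that market forms, and if they disagree there is no Nash equilibrium and no firm offers XAI. Objectives. The number of firms that offer XAI is as listed above (and $0$ if there is no Nash equilibrium). The average XAI level is $\xi_{\mathrm{avg}}=d_1\xi_1+d_2\xi_2$ at equilibrium (and $0$ if there is no Nash equilibrium). *)

theory Defs
  imports "HOL-Analysis.Analysis"
begin

datatype firm = Firm1 | Firm2

datatype differentiation = MaxDiff | MinDiff

fun location :: "differentiation \<Rightarrow> firm \<Rightarrow> real" where
  "location MaxDiff Firm1 = 0"
| "location MaxDiff Firm2 = 1"
| "location MinDiff _ = 1/2"

text \<open>
  The letter is the market (Q quality-dominated, E explanation-dominated), the digit the number
  of firms that offer XAI. The conditions and outcomes below, resulting from the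
  quality and price stages for the given XAI choices, are inputs of the model.
\<close>

datatype equilibrium = Q2 | E0 | E1

fun offering :: "equilibrium \<Rightarrow> firm set" where
  "offering Q2 = {Firm1, Firm2}"
| "offering E0 = {}"
| "offering E1 = {Firm1}"

definition xai :: "real \<Rightarrow> equilibrium \<Rightarrow> firm \<Rightarrow> real" where
  "xai \<xi> m i = (if i \<in> offering m then \<xi> else 0)"

fun possible :: "differentiation \<Rightarrow> real \<Rightarrow> real \<Rightarrow> real \<Rightarrow> equilibrium \<Rightarrow> bool" where
  "possible _ \<beta> t \<xi> Q2 \<longleftrightarrow> \<beta> * t * \<xi> < 4/9"
| "possible MaxDiff \<beta> t \<xi> E0 \<longleftrightarrow>
     \<beta> * t > 1 / (6 * (2 * \<xi>\<^sup>2 - 7 * \<xi> + 6)) \<and> \<xi> \<le> 1 - 1 / (36 * \<beta> * t)"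
| "possible MaxDiff \<beta> t \<xi> E1 \<longleftrightarrow>
     \<beta> * t > 1 / (6 * (2 * \<xi>\<^sup>2 - 7 * \<xi> + 6)) \<and> \<xi> > 1 - 1 / (36 * \<beta> * t)"
| "possible MinDiff \<beta> t \<xi> E0 \<longleftrightarrow> False"
| "possible MinDiff \<beta> t \<xi> E1 \<longleftrightarrow> \<beta> * t * \<xi> > 2/9"

text \<open>
  Coefficients of the outcome of \<open>E1\<close>: under maximal differentiation with \<open>a = \<beta> * t\<close>,
  under minimal differentiation with \<open>\<psi> = \<beta> * t * \<xi>\<close>.
\<close>

fun N_max :: "real \<Rightarrow> real \<Rightarrow> firm \<Rightarrow> real" where
  "N_max a \<xi> Firm1 = 36 * a - 12 * a * \<xi> - 1"
| "N_max a \<xi> Firm2 = 36 * a - 24 * a * \<xi> - 1"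

definition D_max :: "real \<Rightarrow> real \<Rightarrow> real" where
  "D_max a \<xi> = 36 * a - 18 * a * \<xi> - 1"

definition M_max :: "real \<Rightarrow> real \<Rightarrow> real" where
  "M_max a \<xi> = 72 * a - 36 * a * \<xi> - 1"

fun N_min :: "real \<Rightarrow> firm \<Rightarrow> real" where
  "N_min \<psi> Firm1 = 12 * \<psi> - 1"
| "N_min \<psi> Firm2 = 6 * \<psi> - 1"

fun price :: "differentiation \<Rightarrow> real \<Rightarrow> real \<Rightarrow> real \<Rightarrow> equilibrium \<Rightarrow> firm \<Rightarrow> real" where
  "price _ \<beta> t \<xi> Q2 Firm1 = 4 / (27 * \<beta>)"
| "price _ \<beta> t \<xi> Q2 Firm2 = 2 / (27 * \<beta>)"
| "price _ \<beta> t \<xi> E0 _ = t"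
| "price MaxDiff \<beta> t \<xi> E1 i =
     t * (2 - \<xi>) * N_max (\<beta> * t) \<xi> i / (2 * D_max (\<beta> * t) \<xi>)"
| "price MinDiff \<beta> t \<xi> E1 i =
     t * \<xi> * N_min (\<beta> * t * \<xi>) i / (4 * (9 * (\<beta> * t * \<xi>) - 1))"

fun quality :: "differentiation \<Rightarrow> real \<Rightarrow> real \<Rightarrow> real \<Rightarrow> equilibrium \<Rightarrow> firm \<Rightarrow> real" where
  "quality _ \<beta> t \<xi> Q2 Firm1 = 2 / (9 * \<beta>)"
| "quality _ \<beta> t \<xi> Q2 Firm2 = 0"
| "quality _ \<beta> t \<xi> E0 _ = 1 / (12 * \<beta>)"
| "quality MaxDiff \<beta> t \<xi> E1 i =
     N_max (\<beta> * t) \<xi> i / (12 * \<beta> * D_max (\<beta> * t) \<xi>)"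
| "quality MinDiff \<beta> t \<xi> E1 i =
     N_min (\<beta> * t * \<xi>) i / (12 * \<beta> * (9 * (\<beta> * t * \<xi>) - 1))"

fun profit :: "differentiation \<Rightarrow> real \<Rightarrow> real \<Rightarrow> real \<Rightarrow> equilibrium \<Rightarrow> firm \<Rightarrow> real" where
  "profit _ \<beta> t \<xi> Q2 Firm1 = 4 / (81 * \<beta>)"
| "profit _ \<beta> t \<xi> Q2 Firm2 = 2 / (81 * \<beta>)"
| "profit _ \<beta> t \<xi> E0 _ = t / 2 - 1 / (144 * \<beta>)"
| "profit MaxDiff \<beta> t \<xi> E1 i =
     (N_max (\<beta> * t) \<xi> i)\<^sup>2 * M_max (\<beta> * t) \<xi> / (144 * \<beta> * (D_max (\<beta> * t) \<xi>)\<^sup>2)"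
| "profit MinDiff \<beta> t \<xi> E1 i =
     (18 * (\<beta> * t * \<xi>) - 1) * (N_min (\<beta> * t * \<xi>) i)\<^sup>2
       / (144 * \<beta> * (9 * (\<beta> * t * \<xi>) - 1)\<^sup>2)"

text \<open>
  \<open>E0\<close> and \<open>E1\<close> are never possible at the same time, so the inner quantifier compares the Q market
  with the E market: a market forms if it is the only possible one or if both firms earn more in it
  than in the other. A firm with equal profits prefers neither market, hence at most one forms.
\<close>

definition forms :: "differentiation \<Rightarrow> real \<Rightarrow> real \<Rightarrow> real \<Rightarrow> equilibrium \<Rightarrow> bool" where
  "forms d \<beta> t \<xi> m \<longleftrightarrow> possible d \<beta> t \<xi> m \<and>
     (\<forall>m'. possible d \<beta> t \<xi> m' \<and> m' \<noteq> m \<longrightarrow>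
        (\<forall>i. profit d \<beta> t \<xi> m i > profit d \<beta> t \<xi> m' i))"

text \<open>\<open>None\<close> stands for the absence of a Nash equilibrium.\<close>

definition outcome :: "differentiation \<Rightarrow> real \<Rightarrow> real \<Rightarrow> real \<Rightarrow> equilibrium option" where
  "outcome d \<beta> t \<xi> =
     (if \<exists>m. forms d \<beta> t \<xi> m then Some (THE m. forms d \<beta> t \<xi> m) else None)"

definition customers :: "(real \<times> real) set" where
  "customers = {0..1} \<times> {0..1}"

fun utility :: "real \<Rightarrow> differentiation \<Rightarrow> real \<Rightarrow> real \<Rightarrow> real \<Rightarrow> equilibrium \<Rightarrow> firm
    \<Rightarrow> real \<times> real \<Rightarrow> real" where
  "utility V d \<beta> t \<xi> m i (x, \<theta>) =
     V + \<theta> * quality d \<beta> t \<xi> m i - price d \<beta> t \<xi> m i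
       - t * (1 - xai \<xi> m i) * \<bar>x - location d i\<bar>"

definition demand :: "real \<Rightarrow> differentiation \<Rightarrow> real \<Rightarrow> real \<Rightarrow> real \<Rightarrow> equilibrium \<Rightarrow> firm
    \<Rightarrow> real" where
  "demand V d \<beta> t \<xi> m i = measure lborel
     {c \<in> customers. \<forall>j. j \<noteq> i \<longrightarrow> utility V d \<beta> t \<xi> m i c > utility V d \<beta> t \<xi> m j c}"

text \<open>
  The standing assumption on the reservation value: whatever level the policy-maker chooses, in the
  resulting equilibrium (if there is one) every customer's purchase has positive utility.
\<close>

definition covered :: "real \<Rightarrow> differentiation \<Rightarrow> real \<Rightarrow> real \<Rightarrow> bool" where
  "covered V d \<beta> t \<longleftrightarrow>
     (\<forall>\<xi> \<in> {0..1}. \<forall>m. outcome d \<beta> t \<xi> = Some m \<longrightarrow>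
        (\<forall>c \<in> customers. \<exists>i. utility V d \<beta> t \<xi> m i c > 0))"

definition num_offering :: "differentiation \<Rightarrow> real \<Rightarrow> real \<Rightarrow> real \<Rightarrow> nat" where
  "num_offering d \<beta> t \<xi> =
     (case outcome d \<beta> t \<xi> of None \<Rightarrow> 0 | Some m \<Rightarrow> card (offering m))"

definition avg_xai :: "real \<Rightarrow> differentiation \<Rightarrow> real \<Rightarrow> real \<Rightarrow> real \<Rightarrow> real" where
  "avg_xai V d \<beta> t \<xi> =
     (case outcome d \<beta> t \<xi> of
        None \<Rightarrow> 0
      | Some m \<Rightarrow> demand V d \<beta> t \<xi> m Firm1 * xai \<xi> m Firm1
                + demand V d \<beta> t \<xi> m Firm2 * xai \<xi> m Firm2)"

end

theory Submission
  imports Defs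
begin

text \<open>
  Take minimal differentiation with \<open>\<beta> = 1\<close> and \<open>t = 1/3\<close>. At \<open>\<xi> = 1\<close> both markets are possible,
  but the high-quality firm prefers the E market and its rival the Q market, so there is no Nash
  equilibrium and both objectives vanish. At \<open>\<xi> = 1/3\<close> only the Q market is possible, both firms
  offer XAI and both objectives are positive.
\<close>

text \<open>If two different markets formed, firm 1 would earn strictly more in each than in the
  other. This makes the \<open>THE\<close> in \<open>outcome\<close> well defined.\<close>

lemma forms_unique:
  assumes "forms d \<beta> t \<xi> m" "forms d \<beta> t \<xi> m'"
  shows "m = m'"
proof (rule ccontr)
  assume "m \<noteq> m'"
  with assms have "profit d \<beta> t \<xi> m Firm1 > profit d \<beta> t \<xi> m' Firm1"
    and "profit d \<beta> t \<xi> m' Firm1 > profit d \<beta> t \<xi> m Firm1"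
    unfolding forms_def by blast+
  then show False
    by (rule less_asym)
qed

lemma outcome_eq_Some_iff: "outcome d \<beta> t \<xi> = Some m \<longleftrightarrow> forms d \<beta> t \<xi> m"
proof -
  have "(THE m. forms d \<beta> t \<xi> m) = m" if "forms d \<beta> t \<xi> m" for m
    using that forms_unique by blast
  then show ?thesis
    by (auto simp: outcome_def)
qed

lemma outcome_eq_None_iff: "outcome d \<beta> t \<xi> = None \<longleftrightarrow> (\<forall>m. \<not> forms d \<beta> t \<xi> m)"
  by (simp add: outcome_def)

lemma outcome_full: "outcome MinDiff 1 (1/3) 1 = None"
  unfolding outcome_eq_None_iff
proof
  fix m
  show "\<not> forms MinDiff 1 (1/3) 1 m"
  proof (cases m)
    case Q2
    \<comment> \<open>Here \<psi> = 1/3 lies between 2/9 and 4/9. Firm 1 vetoes \<open>Q2\<close>: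
      it earns 4/81 there but 5/64 in \<open>E1\<close>.\<close>
    have "\<not> profit MinDiff 1 (1/3) 1 Q2 Firm1 > profit MinDiff 1 (1/3) 1 E1 Firm1"
      by (simp add: power2_eq_square)
    moreover have "possible MinDiff 1 (1/3) 1 E1"
      by simp
    ultimately show ?thesis
      unfolding Q2 forms_def by blast
  next
    case E0
    then show ?thesis
      by (simp add: forms_def)
  next
    case E1
    \<comment> \<open>Firm 2 vetoes \<open>E1\<close>: it earns 5/576 there but 2/81 in
      \<open>Q2\<close>.\<close>
    have "\<not> profit MinDiff 1 (1/3) 1 E1 Firm2 > profit MinDiff 1 (1/3) 1 Q2 Firm2"
      by (simp add: power2_eq_square)
    moreover have "possible MinDiff 1 (1/3) 1 Q2"
      by simp
    ultimately show ?thesis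
      unfolding E1 forms_def by blast
  qed
qed

lemma outcome_partial: "outcome MinDiff 1 (1/3) (1/3) = Some Q2"
  unfolding outcome_eq_Some_iff forms_def
proof (intro conjI allI impI)
  show "possible MinDiff 1 (1/3) (1/3) Q2"
    by simp
next
  fix m' i
  assume "possible MinDiff 1 (1/3) (1/3) m' \<and> m' \<noteq> Q2"
  \<comment> \<open>Vacuous: \<psi> = 1/9 is below the threshold 2/9 of \<open>E1\<close>, and
    \<open>E0\<close> never occurs under \<open>MinDiff\<close>.\<close>
  then show "profit MinDiff 1 (1/3) (1/3) m' i < profit MinDiff 1 (1/3) (1/3) Q2 i"
    by (cases m') auto
qed

text \<open>One firm with a bounded price suffices in each market: firm 2 in \<open>Q2\<close>
  (price 2/27, quality 0) and firm 1 in \<open>E1\<close> (price at most 1/2, nonnegative quality).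
  The misfit cost is at most 1/6, so either total stays below 1.\<close>

lemma covered_MinDiff:
  assumes "V > 1"
  shows "covered V MinDiff 1 (1/3)"
  unfolding covered_def outcome_eq_Some_iff
proof (intro ballI allI impI)
  fix \<xi> :: real and m and c :: "real \<times> real"
  assume \<xi>: "\<xi> \<in> {0..1}" and m: "forms MinDiff 1 (1/3) \<xi> m" and c: "c \<in> customers"
  obtain x \<theta> where c_eq: "c = (x, \<theta>)"
    by fastforce
  have x: "\<bar>x - 1/2\<bar> \<le> 1/2" and \<theta>: "0 \<le> \<theta>"
    using c by (auto simp: customers_def c_eq abs_if)
  have "(1 - \<xi>) * \<bar>x - 1/2\<bar> \<le> 1 * (1/2)"
    using x \<xi> by (intro mult_mono) auto
  then have misfit: "(1/3) * (1 - \<xi>) * \<bar>x - 1/2\<bar> \<le> 1/6"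
    by simp
  show "\<exists>i. utility V MinDiff 1 (1/3) \<xi> m i c > 0"
  proof (cases m)
    case Q2
    have "utility V MinDiff 1 (1/3) \<xi> m Firm2 c > 0"
      using assms misfit by (simp add: Q2 c_eq xai_def)
    then show ?thesis ..
  next
    case E0
    with m show ?thesis
      by (simp add: forms_def)
  next
    case E1
    \<comment> \<open>This is \<psi> = \<xi>/3 > 2/9; it keeps the denominator factor 9\<psi> - 1 =
      3\<xi> - 1 positive.\<close>
    with m have \<xi>_gt: "\<xi> > 2/3"
      by (simp add: forms_def)
    have price: "price MinDiff 1 (1/3) \<xi> E1 Firm1 \<le> 1/2"
    proof -
      \<comment> \<open>Clearing denominators turns the price bound into \<xi>(4\<xi> - 1) \<le>
        6(3\<xi> - 1).\<close>
      have "\<xi> * (4 * \<xi> - 1) \<le> 1 * (4 * \<xi> - 1)"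
        using \<xi> \<xi>_gt by (intro mult_right_mono) auto
      also have "\<dots> \<le> 6 * (3 * \<xi> - 1)"
        using \<xi>_gt by simp
      finally show ?thesis
        using \<xi>_gt by (simp add: field_simps)
    qed
    have "quality MinDiff 1 (1/3) \<xi> E1 Firm1 \<ge> 0"
      using \<xi>_gt by simp
    with \<theta> have "\<theta> * quality MinDiff 1 (1/3) \<xi> E1 Firm1 \<ge> 0"
      by (rule mult_nonneg_nonneg)
    then have "utility V MinDiff 1 (1/3) \<xi> E1 Firm1 c > 0"
      using assms misfit price
      by (simp add: c_eq xai_def del: price.simps quality.simps)
    then show ?thesis
      unfolding E1 ..
  qed
qed

text \<open>Equal locations and equal XAI levels make the misfit costs cancel. Firm 2 wins exactly
  when the quality gain \<theta> * 2/9 is less than the price gap 2/27, that is \<theta> < 1/3, so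
  its customers fill a rectangle.\<close>

lemma demand_Q2_Firm2: "demand V MinDiff 1 t \<xi> Q2 Firm2 = 1/3"
proof -
  have other_firm: "(\<forall>j. j \<noteq> Firm2 \<longrightarrow> P j) \<longleftrightarrow> P Firm1" for P
    using firm.exhaust by auto
  have "{c \<in> customers. \<forall>j. j \<noteq> Firm2 \<longrightarrow>
      utility V MinDiff 1 t \<xi> Q2 Firm2 c > utility V MinDiff 1 t \<xi> Q2 j c}
    = {0..1} \<times> {0..<1/3}"
    unfolding other_firm by (auto simp: customers_def xai_def)
  moreover have "emeasure lborel ({0..1} \<times> {0..<1/3} :: (real \<times> real) set) = ennreal (1/3)"
    by (simp add: lborel_prod[symmetric] lborel.emeasure_pair_measure_Times)
  ultimately show ?thesis
    by (simp add: demand_def measure_def)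
qed

lemma num_offering_not_arg_max:
  "\<not> is_arg_max (num_offering MinDiff 1 (1/3)) (\<lambda>\<xi>. \<xi> \<in> {0..1}) 1"
proof -
  have "num_offering MinDiff 1 (1/3) 1 < num_offering MinDiff 1 (1/3) (1/3)"
    by (simp add: num_offering_def outcome_full outcome_partial)
  moreover have "(1/3::real) \<in> {0..1}"
    by simp
  ultimately show ?thesis
    unfolding is_arg_max_def by blast
qed

lemma avg_xai_not_arg_max:
  "\<not> is_arg_max (avg_xai V MinDiff 1 (1/3)) (\<lambda>\<xi>. \<xi> \<in> {0..1}) 1"
proof -
  \<comment> \<open>Firm 2 contributes (1/3) * (1/3) = 1/9 to the average, so a nonnegative share of
    firm 1 leaves it positive.\<close>
  have "demand V MinDiff 1 (1/3) (1/3) Q2 Firm1 \<ge> 0"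
    by (simp add: demand_def)
  then have "avg_xai V MinDiff 1 (1/3) 1 < avg_xai V MinDiff 1 (1/3) (1/3)"
    by (simp add: avg_xai_def outcome_full outcome_partial xai_def demand_Q2_Firm2)
  moreover have "(1/3::real) \<in> {0..1}"
    by simp
  ultimately show ?thesis
    unfolding is_arg_max_def by blast
qed

theorem proposition7:
  shows "(\<exists>d \<beta> t. \<beta> > 0 \<and> t > 0 \<and>
            (\<forall>\<^sub>F V in at_top. covered V d \<beta> t \<and>
               \<not> is_arg_max (num_offering d \<beta> t) (\<lambda>\<xi>. \<xi> \<in> {0..1}) 1))
       \<and> (\<exists>d \<beta> t. \<beta> > 0 \<and> t > 0 \<and>
            (\<forall>\<^sub>F V in at_top. covered V d \<beta> t \<and>
               \<not> is_arg_max (avg_xai V d \<beta> t) (\<lambda>\<xi>. \<xi> \<in> {0..1}) 1))"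
proof -
  \<comment> \<open>The same parameters serve both objectives, and every V > 1 is large
    enough.\<close>
  have covered: "\<forall>\<^sub>F V in at_top. covered V MinDiff 1 (1/3)"
    using eventually_gt_at_top[of 1] by eventually_elim (rule covered_MinDiff)
  have "\<forall>\<^sub>F V in at_top. covered V MinDiff 1 (1/3) \<and>
      \<not> is_arg_max (num_offering MinDiff 1 (1/3)) (\<lambda>\<xi>. \<xi> \<in> {0..1}) 1"
    using covered by eventually_elim (simp only: num_offering_not_arg_max simp_thms)
  moreover have "\<forall>\<^sub>F V in at_top. covered V MinDiff 1 (1/3) \<and>
      \<not> is_arg_max (avg_xai V MinDiff 1 (1/3)) (\<lambda>\<xi>. \<xi> \<in> {0..1}) 1"
    using covered by eventually_elim (simp only: avg_xai_not_arg_max simp_thms)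
  ultimately show ?thesis
    by (intro conjI exI[of _ MinDiff] exI[of _ "1::real"] exI[of _ "1/3::real"]) simp_all
qed

end
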